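(* Let $Q\subseteq\mathbb{F}_2^m$ and $R\subseteq\mathbb{F}_2^n$, and let $Q\oplus R:=\{\mathbf{u}\mathbf{v}\mid \mathbf{u}\in Q,\ \mathbf{v}\in R\}\subseteq\mathbb{F}_2^{m+n}$, where $\mathbf{u}\mathbf{v}$ denotes concatenation. Then $Q\oplus R$ is a powerful set if and only if both $Q$ and $R$ are powerful sets.
   Context: A set $S\subseteq\mathbb{F}_2^n$ (positions indexed by $[n]$) is a powerful set if for every $X\subseteq[n]$ the number of vectors in $S$ that are zero in all positions of $X$ is a power of $2$. *)

theory Defs
  imports "HOL-Library.Z2" "Jordan_Normal_Form.Matrix"
begin

text \<open>The space \<open>\<bbbF>\<^sub>2\<^sup>n\<close> is \<open>carrier_vec n :: bit vec set\<close>, where \<open>bit\<close> is the two-element field;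
  its \<open>n\<close> positions are numbered \<open>0, \<dots>, n - 1\<close>. Powers of two include \<open>2 ^ 0 = 1\<close> but not \<open>0\<close>.\<close>

definition powerful_set :: "nat \<Rightarrow> bit vec set \<Rightarrow> bool" where
  "powerful_set n S \<longleftrightarrow> S \<subseteq> carrier_vec n \<and>
     (\<forall>X \<subseteq> {0..<n}. \<exists>k::nat. card {v \<in> S. \<forall>i\<in>X. v $ i = 0} = 2 ^ k)"

definition concat_sum :: "bit vec set \<Rightarrow> bit vec set \<Rightarrow> bit vec set" where
  "concat_sum Q R = {u @\<^sub>v v | u v. u \<in> Q \<and> v \<in> R}"

end

theory Submission
  imports Defs "HOL-Computational_Algebra.Primes"
begin

text \<open>A set of positions of a concatenation splits into positions \<open>X\<close> of the left part and
  (shifted) positions \<open>Y\<close> of the right part, and the number of vectors of the sum vanishing there is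
  the product of the two counts. A product of positive integers is a power of two iff both factors
  are; taking \<open>Y\<close> or \<open>X\<close> empty isolates either factor.\<close>

definition vanishing_on :: "nat set \<Rightarrow> bit vec set \<Rightarrow> bit vec set" where
  "vanishing_on X S = {v \<in> S. \<forall>i\<in>X. v $ i = 0}"

lemma powerful_set_iff:
  "powerful_set n S \<longleftrightarrow>
     S \<subseteq> carrier_vec n \<and> (\<forall>X \<subseteq> {0..<n}. \<exists>k. card (vanishing_on X S) = 2 ^ k)"
  by (simp add: powerful_set_def vanishing_on_def)

text \<open>Index \<open>i < m\<close> of \<open>u @\<^sub>v v\<close> reads \<open>u\<close>, and
  index \<open>m + j\<close> with \<open>j < n\<close> reads \<open>v\<close> at \<open>j\<close>.
  The bounds on \<open>X\<close> and \<open>Y\<close> keep every lookup inside the intended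
  part.\<close>

lemma append_vec_vanishes_iff:
  assumes "u \<in> carrier_vec m" "v \<in> carrier_vec n" "X \<subseteq> {0..<m}" "Y \<subseteq> {0..<n}"
  shows "(\<forall>i \<in> X \<union> (+) m ` Y. (u @\<^sub>v v) $ i = 0) \<longleftrightarrow> (\<forall>i\<in>X. u $ i = 0) \<and> (\<forall>j\<in>Y. v $ j = 0)"
proof -
  have "(u @\<^sub>v v) $ i = u $ i" if "i \<in> X" for i
    using assms that by (auto simp: subset_iff)
  moreover have "(u @\<^sub>v v) $ (m + j) = v $ j" if "j \<in> Y" for j
    using assms that by (auto simp: subset_iff)
  ultimately show ?thesis by (auto simp: ball_Un)
qed

lemma vanishing_on_concat_sum:
  assumes "Q \<subseteq> carrier_vec m" "R \<subseteq> carrier_vec n" "X \<subseteq> {0..<m}" "Y \<subseteq> {0..<n}"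
  shows "vanishing_on (X \<union> (+) m ` Y) (concat_sum Q R) =
    concat_sum (vanishing_on X Q) (vanishing_on Y R)"
proof -
  have "(\<forall>i \<in> X \<union> (+) m ` Y. (u @\<^sub>v v) $ i = 0) \<longleftrightarrow> (\<forall>i\<in>X. u $ i = 0) \<and> (\<forall>j\<in>Y. v $ j = 0)"
    if "u \<in> Q" "v \<in> R" for u v
    using append_vec_vanishes_iff[of u m v n X Y] assms that by blast
  then show ?thesis
    unfolding vanishing_on_def concat_sum_def by blast
qed

text \<open>All left parts have the same length \<open>m\<close>, so a concatenation can be cut back
  in only one way and \<open>(u, v)\<close> is recovered from it. For infinite \<open>R\<close> both
  sides are 0 by the convention on \<open>card\<close>.\<close>

lemma card_concat_sum:
  assumes "Q \<subseteq> carrier_vec m"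
  shows "card (concat_sum Q R) = card Q * card R"
proof -
  have "inj_on (\<lambda>(u, v). u @\<^sub>v v) (Q \<times> R)"
  proof (rule inj_onI, clarify)
    fix u v u' v'
    assume "u \<in> Q" "u' \<in> Q" "u @\<^sub>v v = u' @\<^sub>v v'"
    moreover from this assms have "u \<in> carrier_vec m" "u' \<in> carrier_vec m" by auto
    ultimately show "u = u' \<and> v = v'" by (simp add: append_vec_eq)
  qed
  moreover have "concat_sum Q R = (\<lambda>(u, v). u @\<^sub>v v) ` (Q \<times> R)"
    by (auto simp: concat_sum_def)
  ultimately show ?thesis
    by (simp add: card_image card_cartesian_product)
qed

lemma card_vanishing_on_concat_sum:
  assumes "Q \<subseteq> carrier_vec m" "R \<subseteq> carrier_vec n" "X \<subseteq> {0..<m}" "Y \<subseteq> {0..<n}"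
  shows "card (vanishing_on (X \<union> (+) m ` Y) (concat_sum Q R)) =
    card (vanishing_on X Q) * card (vanishing_on Y R)"
proof -
  have "vanishing_on X Q \<subseteq> carrier_vec m"
    using assms(1) by (auto simp: vanishing_on_def)
  then show ?thesis
    by (simp add: vanishing_on_concat_sum[OF assms] card_concat_sum)
qed

lemma concat_sum_subset_carrier_vec:
  assumes "Q \<subseteq> carrier_vec m" "R \<subseteq> carrier_vec n"
  shows "concat_sum Q R \<subseteq> carrier_vec (m + n)"
  using assms by (auto simp: concat_sum_def subset_iff)

lemma subset_atLeastLessThan_add_split:
  fixes m n :: nat
  assumes "Z \<subseteq> {0..<m + n}"
  obtains X Y where "X \<subseteq> {0..<m}" "Y \<subseteq> {0..<n}" "Z = X \<union> (+) m ` Y"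
proof
  show "Z \<inter> {0..<m} \<subseteq> {0..<m}" by blast
  \<comment> \<open>The right part is the preimage of \<open>Z\<close> under the shift by
    \<open>m\<close>.\<close>
  show "{j. m + j \<in> Z} \<subseteq> {0..<n}" using assms by auto
  have "i \<in> (+) m ` {j. m + j \<in> Z}" if "i \<in> Z" "i \<notin> {0..<m}" for i
    \<comment> \<open>Here \<open>i \<ge> m\<close>, so the subtraction does not truncate and
      \<open>m + (i - m) = i\<close>.\<close>
    using that by (intro image_eqI[of _ _ "i - m"]) auto
  then show "Z = (Z \<inter> {0..<m}) \<union> (+) m ` {j. m + j \<in> Z}" by blast
qed

text \<open>Divisors of a power of the prime 2 are again powers of 2; conversely exponents add. A
  zero factor fails on both sides, which covers empty sets of vectors.\<close>

lemma mult_eq_power_two_iff: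
  fixes a b :: nat
  shows "(\<exists>k. a * b = 2 ^ k) \<longleftrightarrow> (\<exists>k. a = 2 ^ k) \<and> (\<exists>k. b = 2 ^ k)"
proof
  assume "\<exists>k. a * b = 2 ^ k"
  then obtain k where "a * b = 2 ^ k" by blast
  then have "a dvd 2 ^ k" "b dvd 2 ^ k" by (metis dvd_triv_left, metis dvd_triv_right)
  then show "(\<exists>k. a = 2 ^ k) \<and> (\<exists>k. b = 2 ^ k)"
    by (auto simp: divides_primepow_nat[OF two_is_prime_nat])
qed (metis power_add)

theorem theorem9:
  fixes m n :: nat and Q R :: "bit vec set"
  assumes "Q \<subseteq> carrier_vec m" and "R \<subseteq> carrier_vec n"
  shows "powerful_set (m + n) (concat_sum Q R) \<longleftrightarrow> powerful_set m Q \<and> powerful_set n R"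
proof -
  have factor: "(\<exists>k. card (vanishing_on (X \<union> (+) m ` Y) (concat_sum Q R)) = 2 ^ k) \<longleftrightarrow>
      (\<exists>k. card (vanishing_on X Q) = 2 ^ k) \<and> (\<exists>k. card (vanishing_on Y R) = 2 ^ k)"
    if "X \<subseteq> {0..<m}" "Y \<subseteq> {0..<n}" for X Y
    by (simp only: card_vanishing_on_concat_sum[OF assms that] mult_eq_power_two_iff)
  show ?thesis
  proof
    assume "powerful_set (m + n) (concat_sum Q R)"
    then have pow: "\<exists>k. card (vanishing_on Z (concat_sum Q R)) = 2 ^ k" if "Z \<subseteq> {0..<m + n}" for Z
      using that by (simp add: powerful_set_iff)
    have "(\<exists>k. card (vanishing_on X Q) = 2 ^ k) \<and> (\<exists>k. card (vanishing_on Y R) = 2 ^ k)"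
      if "X \<subseteq> {0..<m}" "Y \<subseteq> {0..<n}" for X Y
    proof -
      have "X \<union> (+) m ` Y \<subseteq> {0..<m + n}" using that by (auto simp: subset_iff)
      from pow[OF this] show ?thesis by (simp only: factor[OF that])
    qed
    \<comment> \<open>The first instance has \<open>Y = {}\<close> and leaves \<open>X\<close> free,
      which settles \<open>Q\<close>; the second has \<open>X = {}\<close> and leaves
      \<open>Y\<close> free, which settles \<open>R\<close>.\<close>
    from this[OF _ empty_subsetI] this[OF empty_subsetI]
    show "powerful_set m Q \<and> powerful_set n R"
      using assms by (simp add: powerful_set_iff)
  next
    assume "powerful_set m Q \<and> powerful_set n R"
    \<comment> \<open>Every \<open>Z\<close> has the split form that \<open>factor\<close> handles,
      so \<open>factor\<close> is read from right to left.\<close>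
    then have "\<exists>k. card (vanishing_on Z (concat_sum Q R)) = 2 ^ k" if "Z \<subseteq> {0..<m + n}" for Z
      using subset_atLeastLessThan_add_split[OF that] factor unfolding powerful_set_iff by metis
    then show "powerful_set (m + n) (concat_sum Q R)"
      using concat_sum_subset_carrier_vec[OF assms] by (simp add: powerful_set_iff)
  qed
qed

end
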